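(* Assertion (A) below implies assertion (B) below. (A) For every Nash game with finitely many players $i=1,\dots,p$ whose strategy sets $C_i$ are subsets of Banach spaces $E_i$: if for each $i$ the set $C_i$ is compact, convex and non-empty, and the payoff function $\theta_i$ is continuous on $C$ and quasi-concave in $x_i$, then there exists at least one Nash equilibrium. (B) For every generalized Nash game with finitely many players $i=1,\dots,p$ whose strategy sets $C_i$ are subsets of Banach spaces $E_i$: if for each $i$ the set $C_i$ is compact, convex and non-empty, the payoff function $\theta_i$ is continuous on $C$ and quasi-concave in $x_i$, and the correspondence $K_i$ is lower and upper hemicontinuous with convex, closed and non-empty values, then there exists at least one generalized Nash equilibrium.
   Context: Banach spaces are real and carry their norm topology. A Nash game consists of $p$ players; player $i$ has a strategy set $C_i\subset E_i$ and a payoff function $\theta_i:C\to\mathbb{R}$, where $C=\prod_{i=1}^p C_i$. Put $C^{-i}=\prod_{j\neq i}C_j$ and for $x\in C$ write $x=(x_i,x_{-i})$ with $x_i\in C_i$, $x_{-i}\in C^{-i}$. A Nash equilibrium is $\hat x\in C$ such that for every $i$, $\theta_i(\hat x_i,\hat x_{-i})\geq\theta_i(x_i,\hat x_{-i})$ for all $x_i\in C_i$. In a generalized Nash game each player $i$ has in addition a constraint correspondence $K_i:C^{-i}\rightrightarrows C_i$ (each $x_{-i}$ is sent to a subset $K_i(x_{-i})\subset C_i$). A generalized Nash equilibrium is $\hat x\in C$ such that for every $i$, $\hat x_i\in K_i(\hat x_{-i})$ and $\theta_i(\hat x_i,\hat x_{-i})\geq\theta_i(x_i,\hat x_{-i})$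 for all $x_i\in K_i(\hat x_{-i})$. "$\theta_i$ is quasi-concave in $x_i$" means that for each $x_{-i}$ and $\lambda\in\mathbb{R}$ the set $\{x_i\in C_i:\theta_i(x_i,x_{-i})\geq\lambda\}$ is convex. A correspondence $T:A\rightrightarrows B$ between topological spaces is lower hemicontinuous if for all $a\in A$ and open $V\subset B$ with $T(a)\cap V\neq\emptyset$ there is a neighbourhood $W$ of $a$ with $T(a')\cap V\neq\emptyset$ for all $a'\in W$; upper hemicontinuous if for all $a\in A$ and open $V\subset B$ with $T(a)\subset V$ there is a neighbourhood $W$ of $a$ with $T(a')\subset V$ for all $a'\in W$. *)

theory Defs
  imports "HOL-Analysis.Analysis"
begin

text \<open>
  Different players live in different Banach spaces, and a statement about all games has to
  quantify over these spaces, so they cannot be types of class \<open>banach\<close>. A Banach space is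
  therefore given by a pair \<open>(E, N)\<close>: a linear subspace \<open>E\<close> of an arbitrary real vector space
  type and a complete norm \<open>N\<close> on \<open>E\<close>. Only the linear structure is inherited from the type; no
  norm or topology on the type is involved, and the norms of different players are unrelated.
  Any family of Banach spaces is of this form: embed the spaces into their algebraic direct sum.
\<close>

text \<open>The case distinction is there because \<open>Metric_space\<close> asks for a symmetric and non-negative
  distance on the whole type; the values outside \<open>E\<close> are irrelevant.\<close>

definition norm_dist :: "'a::real_vector set \<Rightarrow> ('a \<Rightarrow> real) \<Rightarrow> 'a \<Rightarrow> 'a \<Rightarrow> real" where
  "norm_dist E N x y = (if x \<in> E \<and> y \<in> E then N (x - y) else 0)"

locale normed_space_on =
  fixes E :: "'a::real_vector set" and N :: "'a \<Rightarrow> real"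
  assumes subspace: "subspace E"
    and norm_eq_0_iff: "x \<in> E \<Longrightarrow> N x = 0 \<longleftrightarrow> x = 0"
    and norm_scale: "x \<in> E \<Longrightarrow> N (a *\<^sub>R x) = \<bar>a\<bar> * N x"
    and norm_triangle: "x \<in> E \<Longrightarrow> y \<in> E \<Longrightarrow> N (x + y) \<le> N x + N y"
begin

lemma norm_minus: "x \<in> E \<Longrightarrow> N (- x) = N x"
  using norm_scale[of x "-1"] by simp

lemma norm_nonneg: "x \<in> E \<Longrightarrow> 0 \<le> N x"
  using norm_triangle[of x "- x"] norm_minus[of x] norm_eq_0_iff[of 0] subspace
  by (simp add: subspace_neg subspace_0)

sublocale Metric_space E "norm_dist E N"
proof
  show "0 \<le> norm_dist E N x y" for x y
    by (simp add: norm_dist_def norm_nonneg subspace subspace_diff)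
  show "norm_dist E N x y = norm_dist E N y x" for x y
    using norm_minus[of "x - y"] by (simp add: norm_dist_def subspace subspace_diff)
  show "norm_dist E N x y = 0 \<longleftrightarrow> x = y" if "x \<in> E" "y \<in> E" for x y
    using that by (simp add: norm_dist_def norm_eq_0_iff subspace subspace_diff)
  show "norm_dist E N x z \<le> norm_dist E N x y + norm_dist E N y z"
    if "x \<in> E" "y \<in> E" "z \<in> E" for x y z
    using that norm_triangle[of "x - y" "y - z"] by (simp add: norm_dist_def subspace subspace_diff)
qed

end

locale banach_space_on = normed_space_on +
  assumes complete: mcomplete

definition norm_topology :: "'a::real_vector set \<Rightarrow> ('a \<Rightarrow> real) \<Rightarrow> 'a topology" where
  "norm_topology E N = Metric_space.mtopology E (norm_dist E N)"

lemma norm_dist_UNIV: "norm_dist UNIV norm = dist"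
  by (simp add: norm_dist_def dist_norm fun_eq_iff)

lemma banach_space_on_UNIV: "banach_space_on (UNIV :: 'a::banach set) norm"
proof -
  interpret normed_space_on "UNIV :: 'a set" norm
    by unfold_locales (auto simp: norm_triangle_ineq)
  show ?thesis
    by unfold_locales (simp add: norm_dist_UNIV mcomplete_iff_complete complete_UNIV)
qed

lemma norm_topology_UNIV: "norm_topology (UNIV :: 'a::banach set) norm = euclidean"
  by (simp add: norm_topology_def norm_dist_UNIV)


text \<open>
  The players are \<open>1, \<dots>, p\<close>. A strategy profile is an extensional function in
  \<open>\<Pi>\<^sub>E i\<in>{1..p}. C i\<close>; a profile \<open>y\<close> of the opponents of player \<open>i\<close> is one in
  \<open>\<Pi>\<^sub>E j\<in>{1..p} - {i}. C j\<close>, and \<open>(x\<^sub>i, y)\<close> is the profile \<open>y(i := x\<^sub>i)\<close>.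
\<close>

definition profiles :: "nat set \<Rightarrow> (nat \<Rightarrow> 'a set) \<Rightarrow> (nat \<Rightarrow> 'a) set" where
  "profiles I C = (\<Pi>\<^sub>E i\<in>I. C i)"

definition opponents :: "nat \<Rightarrow> nat \<Rightarrow> nat set" where
  "opponents p i = {1..p} - {i}"

definition strategy_topology ::
  "('a::real_vector) set \<Rightarrow> ('a \<Rightarrow> real) \<Rightarrow> 'a set \<Rightarrow> 'a topology" where
  "strategy_topology E N C = subtopology (norm_topology E N) C"

definition profile_topology ::
  "nat set \<Rightarrow> (nat \<Rightarrow> 'a::real_vector set) \<Rightarrow> (nat \<Rightarrow> 'a \<Rightarrow> real) \<Rightarrow> (nat \<Rightarrow> 'a set)
    \<Rightarrow> (nat \<Rightarrow> 'a) topology" where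
  "profile_topology I E N C = product_topology (\<lambda>i. strategy_topology (E i) (N i) (C i)) I"

definition quasi_concave_in ::
  "nat \<Rightarrow> (nat \<Rightarrow> 'a::real_vector set) \<Rightarrow> nat \<Rightarrow> ((nat \<Rightarrow> 'a) \<Rightarrow> real) \<Rightarrow> bool" where
  "quasi_concave_in p C i f \<longleftrightarrow>
    (\<forall>y \<in> profiles (opponents p i) C. \<forall>r. convex {z \<in> C i. f (y(i := z)) \<ge> r})"

text \<open>Lower and upper hemicontinuity; the neighbourhood \<open>W\<close> may be taken open.\<close>

definition lower_hemicontinuous ::
  "'b topology \<Rightarrow> 'c topology \<Rightarrow> ('b \<Rightarrow> 'c set) \<Rightarrow> bool" where
  "lower_hemicontinuous X Y T \<longleftrightarrow>
    (\<forall>a \<in> topspace X. \<forall>V. openin Y V \<and> T a \<inter> V \<noteq> {} \<longrightarrow>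
      (\<exists>W. openin X W \<and> a \<in> W \<and> (\<forall>a' \<in> W. T a' \<inter> V \<noteq> {})))"

definition upper_hemicontinuous ::
  "'b topology \<Rightarrow> 'c topology \<Rightarrow> ('b \<Rightarrow> 'c set) \<Rightarrow> bool" where
  "upper_hemicontinuous X Y T \<longleftrightarrow>
    (\<forall>a \<in> topspace X. \<forall>V. openin Y V \<and> T a \<subseteq> V \<longrightarrow>
      (\<exists>W. openin X W \<and> a \<in> W \<and> (\<forall>a' \<in> W. T a' \<subseteq> V)))"

definition nash_equilibrium ::
  "nat \<Rightarrow> (nat \<Rightarrow> 'a set) \<Rightarrow> (nat \<Rightarrow> (nat \<Rightarrow> 'a) \<Rightarrow> real) \<Rightarrow> (nat \<Rightarrow> 'a) \<Rightarrow> bool" where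
  "nash_equilibrium p C \<theta> x \<longleftrightarrow>
    x \<in> profiles {1..p} C \<and>
    (\<forall>i \<in> {1..p}. \<forall>z \<in> C i. \<theta> i x \<ge> \<theta> i ((restrict x (opponents p i))(i := z)))"

definition generalized_nash_equilibrium ::
  "nat \<Rightarrow> (nat \<Rightarrow> 'a set) \<Rightarrow> (nat \<Rightarrow> (nat \<Rightarrow> 'a) \<Rightarrow> real) \<Rightarrow>
    (nat \<Rightarrow> (nat \<Rightarrow> 'a) \<Rightarrow> 'a set) \<Rightarrow> (nat \<Rightarrow> 'a) \<Rightarrow> bool" where
  "generalized_nash_equilibrium p C \<theta> K x \<longleftrightarrow>
    x \<in> profiles {1..p} C \<and>
    (\<forall>i \<in> {1..p}. x i \<in> K i (restrict x (opponents p i)) \<and>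
      (\<forall>z \<in> K i (restrict x (opponents p i)).
        \<theta> i x \<ge> \<theta> i ((restrict x (opponents p i))(i := z))))"

end

theory Submission
  imports Defs
begin

text \<open>
  Given a generalized Nash game and \<open>e > 0\<close>, assertion (A) is applied to an unconstrained game
  with the same players and the same strategy sets, but with new payoffs. Call \<open>z \<in> C\<^sub>i\<close> an
  \<open>e\<close>-approximate reply to \<open>y \<in> C\<^sup>-\<^sup>i\<close> if it lies within distance less than \<open>e\<close> of \<open>K\<^sub>i(y)\<close> and
  its payoff is greater than the payoff of every strategy in \<open>K\<^sub>i(y)\<close> minus \<open>e\<close>. Because the
  inequalities are strict, the set \<open>P\<^sub>e(y)\<close> of these replies is better behaved than the set of
  best replies: it is convex and non-empty, and for each fixed \<open>z\<close> the condition \<open>z \<in> P\<^sub>e(y)\<close> is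
  open in \<open>y\<close> (\<open>openin_approx_replies_lower_section\<close>). As \<open>C\<^sup>-\<^sup>i\<close> is compact and completely
  regular, there are finitely many points \<open>z\<^sub>k\<close> and continuous weights \<open>g\<^sub>k \<ge> 0\<close> with positive sum
  such that \<open>g\<^sub>k(y) > 0\<close> implies \<open>z\<^sub>k \<in> P\<^sub>e(y)\<close> (\<open>approx_replies_weights\<close>). By convexity the weighted
  mean \<open>w(y)\<close> of the \<open>z\<^sub>k\<close> is a continuous selection of \<open>P\<^sub>e\<close>.

  In the auxiliary game player \<open>i\<close> receives \<open>- \<parallel>\<Sum>\<^sub>k g\<^sub>k(x\<^sub>-\<^sub>i) (x\<^sub>i - z\<^sub>k)\<parallel>\<close>, which is a positive multiple
  of \<open>- \<parallel>x\<^sub>i - w(x\<^sub>-\<^sub>i)\<parallel>\<close>. This payoff is continuous and quasi-concave in \<open>x\<^sub>i\<close>, and its maximum \<open>0\<close>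
  is attained only at \<open>x\<^sub>i = w(x\<^sub>-\<^sub>i)\<close>. A Nash equilibrium of the auxiliary game is therefore a profile
  in which every player uses an \<open>e\<close>-approximate reply (\<open>auxiliary_payoff\<close>). It is essential that
  replies depend on the opponents only: otherwise \<open>w\<close> would move with \<open>x\<^sub>i\<close> and quasi-concavity
  would be lost.

  The passage \<open>e \<rightarrow> 0\<close> uses compactness. If \<open>x\<close> is not a generalized equilibrium, then for some
  \<open>e > 0\<close> no profile near \<open>x\<close> consists of \<open>e\<close>-approximate replies (\<open>not_equilibrium_near\<close>). If there
  were no generalized equilibrium at all, finitely many such neighbourhoods would cover \<open>C\<close>, and
  for the smallest of their \<open>e\<close> there would be no approximate equilibrium.
\<close>

section \<open>Weighted sums in a normed space\<close>

context normed_space_on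
begin

lemma topspace_norm_topology: "topspace (norm_topology E N) = E"
  by (simp add: norm_topology_def)

lemma norm_triangle_reverse:
  assumes "x \<in> E" "y \<in> E"
  shows "\<bar>N x - N y\<bar> \<le> N (x - y)"
proof -
  have "x - y \<in> E" "y - x \<in> E"
    using assms subspace by (auto simp: subspace_diff)
  then show ?thesis
    using norm_triangle[of "x - y" y] norm_triangle[of "y - x" x] norm_minus[of "x - y"] assms
    by simp
qed

lemma norm_triangle_sum:
  assumes "\<And>k. k \<in> F \<Longrightarrow> v k \<in> E"
  shows "N (\<Sum>k\<in>F. v k) \<le> (\<Sum>k\<in>F. N (v k))"
  using assms
proof (induction F rule: infinite_finite_induct)
  case (insert k F)
  have "N (v k + sum v F) \<le> N (v k) + N (sum v F)"
    using insert.prems subspace by (intro norm_triangle subspace_sum) auto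
  with insert show ?case by (simp; force)
qed (use norm_eq_0_iff[of 0] subspace in \<open>auto simp: subspace_0\<close>)

lemma continuous_map_norm_topology_tendsto:
  assumes u: "continuous_map X (norm_topology E N) u" and a: "a \<in> topspace X"
  shows "((\<lambda>x. N (u x - u a)) \<longlongrightarrow> 0) (atin X a)"
proof -
  have lim: "limitin mtopology u (u a) (atin X a)"
    using u a unfolding norm_topology_def by (simp add: continuous_map_atin)
  show ?thesis
  proof (rule tendstoI)
    fix e :: real
    assume "e > 0"
    with lim have ev: "\<forall>\<^sub>F x in atin X a. u x \<in> E \<and> norm_dist E N (u x) (u a) < e"
      and ua: "u a \<in> E"
      by (auto simp: limitin_metric)
    show "\<forall>\<^sub>F x in atin X a. dist (N (u x - u a)) 0 < e"
      using ev
    proof eventually_elim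
      case (elim x)
      with ua show ?case
        by (auto simp: norm_dist_def norm_nonneg subspace subspace_diff)
    qed
  qed
qed

text \<open>
  The auxiliary payoff is minus such a norm. Keeping the sum unnormalised avoids division by the
  total weight. The estimate behind continuity at \<open>a\<close> splits each summand of the difference as
  \<open>g\<^sub>k(x) (u(x) - u(a)) + (g\<^sub>k(x) - g\<^sub>k(a)) (u(a) - z\<^sub>k)\<close>.
\<close>

lemma continuous_map_norm_weighted_sum:
  fixes X :: "'b topology"
  assumes fin: "finite F"
    and g: "\<And>k. k \<in> F \<Longrightarrow> continuous_map X euclideanreal (g k)"
    and u: "continuous_map X (norm_topology E N) u"
    and z: "\<And>k. k \<in> F \<Longrightarrow> z k \<in> E"
  shows "continuous_map X euclideanreal (\<lambda>x. N (\<Sum>k\<in>F. g k x *\<^sub>R (u x - z k)))"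
  unfolding continuous_map_atin limitin_canonical_iff
proof
  fix a
  assume a: "a \<in> topspace X"
  define S where "S x = (\<Sum>k\<in>F. g k x *\<^sub>R (u x - z k))" for x
  define B where "B x = (\<Sum>k\<in>F. \<bar>g k x\<bar> * N (u x - u a) + \<bar>g k x - g k a\<bar> * N (u a - z k))" for x
  have uE: "u x \<in> E" if "x \<in> topspace X" for x
    using u that topspace_norm_topology by (fastforce simp: continuous_map_def)
  have SE: "S x \<in> E" if "x \<in> topspace X" for x
    unfolding S_def using uE[OF that] z subspace
    by (intro subspace_sum subspace_scale subspace_diff) auto
  have bound: "\<bar>N (S x) - N (S a)\<bar> \<le> B x" if x: "x \<in> topspace X" for x
  proof -
    have in_E: "u x - u a \<in> E" "k \<in> F \<Longrightarrow> u a - z k \<in> E" for k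
      using uE[OF x] uE[OF a] z subspace by (auto intro: subspace_diff)
    have "S x - S a = (\<Sum>k\<in>F. g k x *\<^sub>R (u x - u a) + (g k x - g k a) *\<^sub>R (u a - z k))"
      unfolding S_def sum_subtractf[symmetric] by (intro sum.cong) (auto simp: algebra_simps)
    moreover have "N (\<Sum>k\<in>F. g k x *\<^sub>R (u x - u a) + (g k x - g k a) *\<^sub>R (u a - z k))
        \<le> (\<Sum>k\<in>F. N (g k x *\<^sub>R (u x - u a) + (g k x - g k a) *\<^sub>R (u a - z k)))"
      using in_E subspace by (intro norm_triangle_sum subspace_add subspace_scale) auto
    moreover have "\<dots> \<le> B x"
      unfolding B_def
    proof (rule sum_mono)
      fix k
      assume k: "k \<in> F"
      have "N (g k x *\<^sub>R (u x - u a) + (g k x - g k a) *\<^sub>R (u a - z k))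
          \<le> N (g k x *\<^sub>R (u x - u a)) + N ((g k x - g k a) *\<^sub>R (u a - z k))"
        using in_E k subspace by (intro norm_triangle subspace_scale) auto
      then show "N (g k x *\<^sub>R (u x - u a) + (g k x - g k a) *\<^sub>R (u a - z k))
          \<le> \<bar>g k x\<bar> * N (u x - u a) + \<bar>g k x - g k a\<bar> * N (u a - z k)"
        using in_E k by (simp add: norm_scale)
    qed
    ultimately have "N (S x - S a) \<le> B x"
      by simp
    then show ?thesis
      using norm_triangle_reverse[OF SE[OF x] SE[OF a]] by (rule order_trans[rotated])
  qed
  have g_lim: "(g k \<longlongrightarrow> g k a) (atin X a)" if "k \<in> F" for k
    using g[OF that] a by (simp add: continuous_map_atin)
  have "(B \<longlongrightarrow> (\<Sum>k\<in>F. \<bar>g k a\<bar> * 0 + \<bar>g k a - g k a\<bar> * N (u a - z k))) (atin X a)"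
    unfolding B_def
    by (intro tendsto_intros g_lim continuous_map_norm_topology_tendsto u a)
  then have "(B \<longlongrightarrow> 0) (atin X a)"
    by simp
  moreover have "\<forall>\<^sub>F x in atin X a. norm (N (S x) - N (S a)) \<le> B x"
    using bound a by (auto simp: eventually_atin intro!: exI[of _ "topspace X"])
  ultimately have "((\<lambda>x. N (S x) - N (S a)) \<longlongrightarrow> 0) (atin X a)"
    by (rule Lim_null_comparison[rotated])
  then show "((\<lambda>x. N (\<Sum>k\<in>F. g k x *\<^sub>R (u x - z k))) \<longlongrightarrow> N (\<Sum>k\<in>F. g k a *\<^sub>R (u a - z k)))
      (atin X a)"
    unfolding S_def by (rule LIM_zero_cancel)
qed

lemma continuous_map_norm_diff:
  assumes "c \<in> E"
  shows "continuous_map (strategy_topology E N C) euclideanreal (\<lambda>x. N (x - c))"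
proof -
  have "continuous_map (strategy_topology E N C) (norm_topology E N) (\<lambda>x. x)"
    unfolding strategy_topology_def by (intro continuous_map_from_subtopology) simp
  then show ?thesis
    using continuous_map_norm_weighted_sum
      [of "{()}" "strategy_topology E N C" "\<lambda>_ _. 1" "\<lambda>x. x" "\<lambda>_. c"] assms
    by simp
qed

text \<open>
  The vector inside the norm is an affine function of \<open>x\<close>, so the norm is convex in \<open>x\<close>. This
  gives the quasi-concavity of the auxiliary payoff.
\<close>

lemma convex_norm_weighted_sum:
  assumes "convex C" "C \<subseteq> E" "\<And>k. k \<in> F \<Longrightarrow> z k \<in> E"
  shows "convex {x \<in> C. N (\<Sum>k\<in>F. c k *\<^sub>R (x - z k)) \<le> r}"
proof (rule convexI)
  fix x y :: 'a and a b :: real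
  assume x: "x \<in> {x \<in> C. N (\<Sum>k\<in>F. c k *\<^sub>R (x - z k)) \<le> r}"
    and y: "y \<in> {x \<in> C. N (\<Sum>k\<in>F. c k *\<^sub>R (x - z k)) \<le> r}"
    and ab: "0 \<le> a" "0 \<le> b" "a + b = 1"
  define S where "S x = (\<Sum>k\<in>F. c k *\<^sub>R (x - z k))" for x
  have SE: "S x \<in> E" if "x \<in> C" for x
    unfolding S_def using that assms subspace
    by (intro subspace_sum subspace_scale subspace_diff) auto
  have comb: "a *\<^sub>R x + b *\<^sub>R y - w = a *\<^sub>R (x - w) + b *\<^sub>R (y - w)" for w
  proof -
    have "a *\<^sub>R x + b *\<^sub>R y - (a + b) *\<^sub>R w = a *\<^sub>R (x - w) + b *\<^sub>R (y - w)"
      by (simp add: algebra_simps)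
    then show ?thesis
      using ab by simp
  qed
  have "S (a *\<^sub>R x + b *\<^sub>R y) = a *\<^sub>R S x + b *\<^sub>R S y"
    unfolding S_def comb scaleR_sum_right sum.distrib[symmetric]
    by (intro sum.cong) (simp_all add: scaleR_add_right mult.commute)
  moreover have "N (a *\<^sub>R S x + b *\<^sub>R S y) \<le> a * N (S x) + b * N (S y)"
    using norm_triangle[of "a *\<^sub>R S x" "b *\<^sub>R S y"] SE x y ab subspace
    by (simp add: subspace_scale norm_scale)
  moreover have "a * N (S x) + b * N (S y) \<le> a * r + b * r"
    using x y ab unfolding S_def by (intro add_mono mult_left_mono) auto
  moreover have "a * r + b * r = r"
    using ab by (metis mult_1 distrib_right)
  moreover have "a *\<^sub>R x + b *\<^sub>R y \<in> C"
    using x y ab assms(1) by (simp add: convex_def)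
  ultimately show "a *\<^sub>R x + b *\<^sub>R y \<in> {x \<in> C. N (\<Sum>k\<in>F. c k *\<^sub>R (x - z k)) \<le> r}"
    unfolding S_def by simp
qed

end


section \<open>Approximate best replies under a constraint\<close>

lemma compact_space_neighbourhood_cover:
  assumes "compact_space X"
    and "\<And>x. x \<in> topspace X \<Longrightarrow> openin X (U x)" "\<And>x. x \<in> topspace X \<Longrightarrow> x \<in> U x"
  obtains F where "finite F" "F \<subseteq> topspace X" "topspace X \<subseteq> (\<Union>x\<in>F. U x)"
proof -
  have "topspace X \<subseteq> \<Union> (U ` topspace X)"
    using assms(3) by blast
  with assms(2) obtain \<F> where "finite \<F>" "\<F> \<subseteq> U ` topspace X" and cover: "topspace X \<subseteq> \<Union>\<F>"
    using assms(1)[unfolded compact_space_alt, rule_format, of "U ` topspace X"] by blast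
  then obtain F where "F \<subseteq> topspace X" "finite F" "\<F> = U ` F"
    using finite_subset_image by meson
  with cover show thesis
    by (intro that[of F]) auto
qed

text \<open>
  Here \<open>y\<close> stands for the strategies of the opponents and \<open>f y z\<close> for the payoff of the player's own
  strategy \<open>z\<close>. A reply may violate the constraint by less than \<open>e\<close>: membership in \<open>K y\<close> itself need
  not be an open condition on \<open>y\<close>.
\<close>

definition approx_replies ::
  "('a::real_vector \<Rightarrow> real) \<Rightarrow> 'a set \<Rightarrow> ('b \<Rightarrow> 'a \<Rightarrow> real) \<Rightarrow> ('b \<Rightarrow> 'a set) \<Rightarrow> real \<Rightarrow> 'b \<Rightarrow> 'a set"
where
  "approx_replies N C f K e y =
    {z \<in> C. (\<exists>k \<in> K y. N (z - k) < e) \<and> (\<forall>k \<in> K y. f y k - e < f y z)}"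

lemma approx_replies_mono:
  "e \<le> e' \<Longrightarrow> approx_replies N C f K e y \<subseteq> approx_replies N C f K e' y"
  unfolding approx_replies_def by force

text \<open>
  The problem faced by one player, with the profiles of the opponents replaced by an arbitrary
  topological space of parameters.
\<close>

locale constrained_maximization = normed_space_on E N
  for E :: "'a::real_vector set" and N :: "'a \<Rightarrow> real" +
  fixes C :: "'a set" and X :: "'b topology" and f :: "'b \<Rightarrow> 'a \<Rightarrow> real" and K :: "'b \<Rightarrow> 'a set"
  assumes C_subset: "C \<subseteq> E"
    and compact_C: "compactin (norm_topology E N) C"
    and convex_C: "convex C"
    and f_continuous:
      "continuous_map (prod_topology X (strategy_topology E N C)) euclideanreal (\<lambda>(y, z). f y z)"
    and f_quasi_concave: "y \<in> topspace X \<Longrightarrow> convex {z \<in> C. f y z \<ge> r}"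
    and K_subset: "y \<in> topspace X \<Longrightarrow> K y \<subseteq> C"
    and K_convex: "y \<in> topspace X \<Longrightarrow> convex (K y)"
    and K_closed: "y \<in> topspace X \<Longrightarrow> closedin (strategy_topology E N C) (K y)"
    and K_nonempty: "y \<in> topspace X \<Longrightarrow> K y \<noteq> {}"
    and K_lhc: "lower_hemicontinuous X (strategy_topology E N C) K"
    and K_uhc: "upper_hemicontinuous X (strategy_topology E N C) K"
begin

abbreviation "Y \<equiv> strategy_topology E N C"
abbreviation "P \<equiv> approx_replies N C f K"

lemma topspace_Y: "topspace Y = C"
  using C_subset by (auto simp: strategy_topology_def topspace_norm_topology)

lemma compactin_K:
  assumes "y \<in> topspace X"
  shows "compactin Y (K y)"
proof -
  have "compact_space Y"
    unfolding strategy_topology_def by (rule compact_space_subtopology[OF compact_C])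
  then show ?thesis
    using K_closed[OF assms] closedin_compact_space by blast
qed

lemma K_lhcE:
  assumes "y \<in> topspace X" "openin Y V" "k \<in> K y" "k \<in> V"
  obtains W where "openin X W" "y \<in> W" "\<forall>y' \<in> W. K y' \<inter> V \<noteq> {}"
proof -
  have "K y \<inter> V \<noteq> {}"
    using assms by blast
  then show thesis
    using K_lhc[unfolded lower_hemicontinuous_def, rule_format, of y V] assms(1,2) that by blast
qed

lemma K_uhcE:
  assumes "y \<in> topspace X" "openin Y V" "K y \<subseteq> V"
  obtains W where "openin X W" "y \<in> W" "\<forall>y' \<in> W. K y' \<subseteq> V"
  using K_uhc[unfolded upper_hemicontinuous_def, rule_format, of y V] assms that by blast

lemma f_continuous_snd:
  assumes "y \<in> topspace X"
  shows "continuous_map Y euclideanreal (f y)"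
proof -
  have "continuous_map Y (prod_topology X Y) (\<lambda>z. (y, z))"
    using assms by (intro continuous_map_pairedI) auto
  from continuous_map_compose[OF this f_continuous] show ?thesis
    by (simp add: comp_def)
qed

lemma f_continuous_fst:
  assumes "z \<in> C"
  shows "continuous_map (prod_topology X Y) euclideanreal (\<lambda>w. f (fst w) z)"
proof -
  have "continuous_map (prod_topology X Y) (prod_topology X Y) (\<lambda>w. (fst w, z))"
    using assms topspace_Y by (intro continuous_map_pairedI) (auto simp: continuous_map_fst)
  from continuous_map_compose[OF this f_continuous] show ?thesis
    by (simp add: comp_def case_prod_beta)
qed

lemma approx_replies_nonempty:
  assumes y: "y \<in> topspace X" and e: "e > 0"
  shows "P e y \<noteq> {}"
proof -
  have "compact (f y ` K y)"
    using image_compactin[OF compactin_K[OF y] f_continuous_snd[OF y]] by simp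
  then obtain z where z: "z \<in> K y" "\<And>k. k \<in> K y \<Longrightarrow> f y k \<le> f y z"
    using compact_attains_sup[of "f y ` K y"] K_nonempty[OF y] by auto
  have "N (z - z) = 0"
    using norm_eq_0_iff[of 0] subspace by (simp add: subspace_0)
  then have "z \<in> P e y"
    using z e K_subset[OF y] unfolding approx_replies_def by force
  then show ?thesis by blast
qed

lemma convex_approx_replies:
  assumes y: "y \<in> topspace X"
  shows "convex (P e y)"
proof (rule convexI)
  fix u v :: 'a and a b :: real
  assume u: "u \<in> P e y" and v: "v \<in> P e y" and ab: "0 \<le> a" "0 \<le> b" "a + b = 1"
  let ?w = "a *\<^sub>R u + b *\<^sub>R v"
  from u v obtain k l where k: "k \<in> K y" "N (u - k) < e" and l: "l \<in> K y" "N (v - l) < e"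
    and uvC: "u \<in> C" "v \<in> C"
    unfolding approx_replies_def by blast
  have inE: "u - k \<in> E" "v - l \<in> E"
    using uvC k l K_subset[OF y] C_subset subspace by (auto intro!: subspace_diff)
  have "?w - (a *\<^sub>R k + b *\<^sub>R l) = a *\<^sub>R (u - k) + b *\<^sub>R (v - l)"
    by (simp add: algebra_simps)
  then have "N (?w - (a *\<^sub>R k + b *\<^sub>R l)) \<le> a * N (u - k) + b * N (v - l)"
    using norm_triangle[of "a *\<^sub>R (u - k)" "b *\<^sub>R (v - l)"] inE ab subspace
    by (simp add: subspace_scale norm_scale)
  also have "\<dots> < e"
    using k l ab by (intro convex_bound_lt) auto
  finally have near: "\<exists>m \<in> K y. N (?w - m) < e"
    using K_convex[OF y] k l ab by (meson convex_def)
  let ?r = "min (f y u) (f y v)"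
  have "?w \<in> {z \<in> C. f y z \<ge> ?r}"
    using uvC ab by (intro convexD[OF f_quasi_concave[OF y]]) auto
  moreover have "\<forall>m \<in> K y. f y m - e < ?r"
    using u v unfolding approx_replies_def by auto
  ultimately have "?w \<in> C" "\<forall>m \<in> K y. f y m - e < f y ?w"
    by fastforce+
  with near show "?w \<in> P e y"
    unfolding approx_replies_def by blast
qed

text \<open>
  The two halves of the definition need the two hemicontinuity assumptions. A point of \<open>K y\<close> close
  to \<open>z\<close> persists for nearby parameters by lower hemicontinuity. The strict payoff inequality holds
  on a product neighbourhood of \<open>{y} \<times> K y\<close> by compactness of \<open>K y\<close>, and upper hemicontinuity
  keeps the nearby constraint sets inside that neighbourhood.
\<close>

lemma openin_approx_replies_lower_section:
  "openin X {y \<in> topspace X. z \<in> P e y}"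
proof (subst openin_subopen, intro ballI)
  fix y
  assume "y \<in> {y \<in> topspace X. z \<in> P e y}"
  then have y: "y \<in> topspace X" and zP: "z \<in> P e y" by auto
  then obtain k where zC: "z \<in> C" and k: "k \<in> K y" "N (z - k) < e"
    and opt: "\<And>m. m \<in> K y \<Longrightarrow> f y m - e < f y z"
    unfolding approx_replies_def by blast
  have sym: "N (z - m) = N (m - z)" if "m \<in> C" for m
  proof -
    have "m - z \<in> E"
      using that zC C_subset subspace by (auto intro: subspace_diff)
    then show ?thesis
      using norm_minus[of "m - z"] by simp
  qed
  let ?V = "{m \<in> topspace Y. N (m - z) \<in> {..<e}}"
  have openV: "openin Y ?V"
    using zC C_subset
    by (intro openin_continuous_map_preimage[OF continuous_map_norm_diff]) auto
  have "k \<in> C"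
    using k(1) K_subset[OF y] by blast
  then have "k \<in> ?V"
    using k(2) sym topspace_Y by simp
  then obtain W1 where W1: "openin X W1" "y \<in> W1" "\<forall>y' \<in> W1. K y' \<inter> ?V \<noteq> {}"
    by (rule K_lhcE[OF y openV k(1)])
  let ?O = "{w \<in> topspace (prod_topology X Y). (case w of (y', m) \<Rightarrow> f y' m) -
      f (fst w) z \<in> {..<e}}"
  have openO: "openin (prod_topology X Y) ?O"
    by (rule openin_continuous_map_preimage[OF continuous_map_diff[OF f_continuous f_continuous_fst[OF zC]]])
      simp
  have "(y, m) \<in> ?O" if m: "m \<in> K y" for m
  proof -
    have "m \<in> C"
      using m K_subset[OF y] by blast
    then show ?thesis
      using y topspace_Y opt[OF m] by simp
  qed
  then have subO: "{y} \<times> K y \<subseteq> ?O"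
    by blast
  have "compactin X {y}"
    using y by simp
  then obtain U V where UV: "openin X U" "openin Y V" "{y} \<subseteq> U" "K y \<subseteq> V" "U \<times> V \<subseteq> ?O"
    by (rule Wallace_theorem_prod_topology[OF _ compactin_K[OF y] openO subO])
  obtain W2 where W2: "openin X W2" "y \<in> W2" "\<forall>y' \<in> W2. K y' \<subseteq> V"
    by (rule K_uhcE[OF y UV(2,4)])
  have "z \<in> P e y'" if y': "y' \<in> W1 \<inter> U \<inter> W2" for y'
  proof -
    from W1(3) y' obtain m where "m \<in> K y'" "m \<in> C" "N (m - z) < e"
      using topspace_Y by auto
    then have "\<exists>m \<in> K y'. N (z - m) < e"
      using sym by metis
    moreover have "f y' m - e < f y' z" if "m \<in> K y'" for m
    proof -
      have "(y', m) \<in> ?O"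
        using that y' W2(3) UV(5) by blast
      then show ?thesis by simp
    qed
    ultimately show ?thesis
      using zC unfolding approx_replies_def by blast
  qed
  moreover have "openin X (W1 \<inter> U \<inter> W2)" "y \<in> W1 \<inter> U \<inter> W2"
    using W1 W2 UV by auto
  ultimately show "\<exists>T. openin X T \<and> y \<in> T \<and> T \<subseteq> {y \<in> topspace X. z \<in> P e y}"
    using openin_subset by (intro exI[of _ "W1 \<inter> U \<inter> W2"]) blast
qed

text \<open>
  An unnormalised partition of unity subordinate to the open sets \<open>{y. z \<in> P e y}\<close>. The chosen
  replies \<open>z\<close> are indexed by the parameters for which they were chosen. Complete regularity supplies
  for each parameter a weight that is positive there and vanishes where \<open>z\<close> is no approximate
  reply; compactness leaves finitely many of them.
\<close>

lemma approx_replies_weights: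
  assumes "compact_space X" "completely_regular_space X" "e > 0"
  obtains F :: "'b set" and z g where "finite F"
    "\<forall>k\<in>F. z k \<in> C \<and> continuous_map X euclideanreal (g k) \<and>
      (\<forall>y\<in>topspace X. 0 \<le> g k y \<and> (0 < g k y \<longrightarrow> z k \<in> P e y))"
    "\<forall>y\<in>topspace X. 0 < (\<Sum>k\<in>F. g k y)"
proof -
  have "\<exists>z g. z \<in> P e y \<and> continuous_map X euclideanreal g \<and> 0 < g y
     \<and> (\<forall>y' \<in> topspace X. 0 \<le> g y' \<and> (0 < g y' \<longrightarrow> z \<in> P e y'))"
    if y: "y \<in> topspace X" for y
  proof -
    obtain z where z: "z \<in> P e y"
      using approx_replies_nonempty[OF y \<open>e > 0\<close>] by blast
    let ?U = "{y \<in> topspace X. z \<in> P e y}"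
    have "closedin X (topspace X - ?U)"
      using openin_approx_replies_lower_section[of z e] by blast
    moreover have "y \<in> topspace X - (topspace X - ?U)"
      using y z by simp
    ultimately obtain h :: "'b \<Rightarrow> real" where h: "continuous_map X (top_of_set {0..1}) h" "h y = 0"
      "h ` (topspace X - ?U) \<subseteq> {1}"
      using assms(2) unfolding completely_regular_space_def by meson
    have cont: "continuous_map X euclideanreal (\<lambda>y. 1 - h y)"
      using h(1) by (intro continuous_intros) (simp add: continuous_map_in_subtopology)
    have le: "h y' \<le> 1" if "y' \<in> topspace X" for y'
      using h(1) that by (force simp: continuous_map_in_subtopology)
    have "z \<in> P e y'" if "y' \<in> topspace X" "0 < 1 - h y'" for y'
      using h(3) that by force
    with cont le z h(2) show ?thesis
      by (intro exI[of _ z] exI[of _ "\<lambda>y. 1 - h y"]) auto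
  qed
  then obtain z g where "\<forall>y \<in> topspace X. z y \<in> P e y \<and> continuous_map X euclideanreal (g y)
      \<and> 0 < g y y \<and> (\<forall>y' \<in> topspace X. 0 \<le> g y y' \<and> (0 < g y y' \<longrightarrow> z y \<in> P e y'))"
    by metis
  then have zg: "\<And>y. y \<in> topspace X \<Longrightarrow> z y \<in> P e y"
      "\<And>y. y \<in> topspace X \<Longrightarrow> continuous_map X euclideanreal (g y)"
      "\<And>y. y \<in> topspace X \<Longrightarrow> 0 < g y y"
      "\<And>y y'. y \<in> topspace X \<Longrightarrow> y' \<in> topspace X \<Longrightarrow> 0 \<le> g y y'"
      "\<And>y y'. y \<in> topspace X \<Longrightarrow> y' \<in> topspace X \<Longrightarrow> 0 < g y y' \<Longrightarrow> z y \<in> P e y'"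
    by blast+
  let ?U = "\<lambda>y. {y' \<in> topspace X. g y y' \<in> {0<..}}"
  have "openin X (?U y)" if "y \<in> topspace X" for y
    by (rule openin_continuous_map_preimage[OF zg(2)[OF that]]) simp
  moreover have "y \<in> ?U y" if "y \<in> topspace X" for y
    using zg(3) that by simp
  ultimately obtain F where F: "finite F" "F \<subseteq> topspace X" "topspace X \<subseteq> \<Union> (?U ` F)"
    by (rule compact_space_neighbourhood_cover[OF assms(1)])
  have pos: "0 < (\<Sum>k\<in>F. g k y)" if y: "y \<in> topspace X" for y
  proof -
    from F(3) y obtain k where "k \<in> F" "0 < g k y" by auto
    then show ?thesis
      using F(1,2) zg(4) y by (intro sum_pos2[of F k]) auto
  qed
  have zC: "z k \<in> C" if "k \<in> F" for k
    using zg(1)[of k] F(2) that unfolding approx_replies_def by auto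
  show thesis
    by (rule that[of F z g]) (use F zC zg pos in blast)+
qed

text \<open>
  A strategy \<open>x\<close> can fail to be an exact best reply to \<open>y\<close> in two ways. If it violates the constraint,
  then it has positive distance \<open>3 d\<close> to the compact set \<open>K y\<close>, and by upper hemicontinuity the nearby
  constraint sets stay away from \<open>x\<close>. If some \<open>k \<in> K y\<close> has a payoff that is better by \<open>3 d\<close>, then by
  lower hemicontinuity the nearby constraint sets contain points near \<open>k\<close>, which still beat every
  strategy near \<open>x\<close> by more than \<open>d\<close>. In both cases \<open>e = d\<close> works: the other two thirds of the gap
  absorb the perturbations.
\<close>

lemma not_approx_reply_near:
  assumes y: "y \<in> topspace X" and x: "x \<in> C" and no: "\<not> (x \<in> K y \<and> (\<forall>k \<in> K y. f y k \<le> f y x))"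
  obtains W e where "openin (prod_topology X Y) W" "(y, x) \<in> W" "e > 0"
    "\<And>y' x'. (y', x') \<in> W \<Longrightarrow> x' \<notin> P e y'"
proof (cases "x \<in> K y")
  case False
  have cont: "continuous_map Y euclideanreal (\<lambda>k. N (k - x))"
    using x C_subset by (intro continuous_map_norm_diff) auto
  have "compact ((\<lambda>k. N (k - x)) ` K y)"
    using image_compactin[OF compactin_K[OF y] cont] by simp
  then obtain m where m: "m \<in> K y" "\<And>k. k \<in> K y \<Longrightarrow> N (m - x) \<le> N (k - x)"
    using compact_attains_inf[of "(\<lambda>k. N (k - x)) ` K y"] K_nonempty[OF y] by auto
  have mx: "m - x \<in> E" "m - x \<noteq> 0"
    using m(1) K_subset[OF y] x C_subset subspace False by (auto intro!: subspace_diff)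
  define d where "d = N (m - x) / 3"
  have d: "d > 0"
    using norm_nonneg[OF mx(1)] norm_eq_0_iff[OF mx(1)] mx(2) unfolding d_def by simp
  let ?V = "{k \<in> topspace Y. N (k - x) \<in> {2*d<..}}"
  have openV: "openin Y ?V"
    by (rule openin_continuous_map_preimage[OF cont]) simp
  have "k \<in> ?V" if k: "k \<in> K y" for k
  proof -
    have "2 * d < N (k - x)"
      using m(2)[OF k] d unfolding d_def by simp
    then show ?thesis
      using k K_subset[OF y] topspace_Y by auto
  qed
  then have subV: "K y \<subseteq> ?V"
    by blast
  obtain W where W: "openin X W" "y \<in> W" "\<forall>y' \<in> W. K y' \<subseteq> ?V"
    by (rule K_uhcE[OF y openV subV])
  let ?B = "{k \<in> topspace Y. N (k - x) \<in> {..<d}}"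
  have B: "openin Y ?B"
    by (rule openin_continuous_map_preimage[OF cont]) auto
  have "N (x - x) = 0"
    using norm_eq_0_iff[of 0] subspace by (simp add: subspace_0)
  then have "x \<in> ?B"
    using x topspace_Y d by simp
  moreover have "x' \<notin> P d y'" if "(y', x') \<in> W \<times> ?B" for y' x'
  proof
    assume "x' \<in> P d y'"
    then obtain k where k: "k \<in> K y'" "N (x' - k) < d"
      unfolding approx_replies_def by blast
    then have kC: "k \<in> C" "N (k - x) > 2*d" and x'C: "x' \<in> C" "N (x' - x) < d"
      using W(3) that topspace_Y by auto
    then have "k - x' \<in> E" "x' - x \<in> E"
      using x C_subset subspace by (auto intro!: subspace_diff)
    then show False
      using norm_triangle[of "k - x'" "x' - x"] norm_minus[of "k - x'"] k kC x'C by simp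
  qed
  ultimately show thesis
    using that[of "W \<times> ?B" d] W B d by (simp add: openin_prod_Times_iff)
next
  case True
  with no obtain k where k: "k \<in> K y" "f y k > f y x" by auto
  define d where "d = (f y k - f y x) / 3"
  have d: "d > 0"
    using k unfolding d_def by simp
  let ?O1 = "{w \<in> topspace (prod_topology X Y). (case w of (y', m) \<Rightarrow> f y' m) \<in> {f y k - d<..}}"
  have O1: "openin (prod_topology X Y) ?O1"
    by (rule openin_continuous_map_preimage[OF f_continuous]) auto
  have "k \<in> C"
    using k(1) K_subset[OF y] by blast
  then have "(y, k) \<in> ?O1"
    using y topspace_Y d by simp
  then obtain W1 V1 where WV: "openin X W1" "openin Y V1" "y \<in> W1" "k \<in> V1" "W1 \<times> V1 \<subseteq> ?O1"
    using O1[unfolded openin_prod_topology_alt, rule_format, of y k] by blast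
  obtain W2 where W2: "openin X W2" "y \<in> W2" "\<forall>y' \<in> W2. K y' \<inter> V1 \<noteq> {}"
    by (rule K_lhcE[OF y WV(2) k(1) WV(4)])
  let ?O2 = "{w \<in> topspace (prod_topology X Y). (case w of (y', m) \<Rightarrow> f y' m) \<in> {..<f y x + d}}"
  have O2: "openin (prod_topology X Y) ?O2"
    by (rule openin_continuous_map_preimage[OF f_continuous]) auto
  let ?W = "?O2 \<inter> ((W1 \<inter> W2) \<times> topspace Y)"
  have W: "openin (prod_topology X Y) ?W"
    using O2 WV(1) W2(1) by (intro openin_Int) (auto simp: openin_prod_Times_iff)
  have yx: "(y, x) \<in> ?W"
    using y x topspace_Y d WV(3) W2(2) by simp
  have far: "x' \<notin> P d y'" if w: "(y', x') \<in> ?W" for y' x'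
  proof
    assume x'P: "x' \<in> P d y'"
    from W2(3) w obtain k' where k': "k' \<in> K y'" "k' \<in> V1" by auto
    then have "(y', k') \<in> ?O1"
      using w WV(5) by blast
    then have "f y' k' > f y k - d" by simp
    moreover have "f y' x' < f y x + d"
      using w by simp
    moreover have "f y' k' - d < f y' x'"
      using x'P k'(1) unfolding approx_replies_def by blast
    ultimately show False
      unfolding d_def by argo
  qed
  show thesis
    by (rule that[OF W yx d far])
qed

end


section \<open>Strategy profiles\<close>

lemma topspace_profile_topology:
  assumes "\<And>i. i \<in> I \<Longrightarrow> normed_space_on (E i) (N i)" "\<And>i. i \<in> I \<Longrightarrow> C i \<subseteq> E i"
  shows "topspace (profile_topology I E N C) = profiles I C"
proof -
  have "topspace (strategy_topology (E i) (N i) (C i)) = C i" if "i \<in> I" for i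
    using assms[OF that] normed_space_on.topspace_norm_topology[of "E i" "N i"]
    by (auto simp: strategy_topology_def)
  then show ?thesis
    by (simp add: profile_topology_def profiles_def cong: PiE_cong)
qed

lemma compact_space_profile_topology:
  assumes "\<And>i. i \<in> I \<Longrightarrow> compactin (norm_topology (E i) (N i)) (C i)"
  shows "compact_space (profile_topology I E N C)"
  using assms unfolding profile_topology_def strategy_topology_def
  by (auto simp: compact_space_product_topology intro: compact_space_subtopology)

lemma completely_regular_space_profile_topology:
  assumes "\<And>i. i \<in> I \<Longrightarrow> normed_space_on (E i) (N i)"
  shows "completely_regular_space (profile_topology I E N C)"
proof -
  have "completely_regular_space (strategy_topology (E i) (N i) (C i))" if "i \<in> I" for i
  proof -
    interpret normed_space_on "E i" "N i" using assms[OF that] .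
    show ?thesis
      unfolding strategy_topology_def norm_topology_def
      by (intro completely_regular_space_subtopology metrizable_imp_completely_regular_space
          metrizable_space_mtopology)
  qed
  then show ?thesis
    unfolding profile_topology_def completely_regular_space_product_topology by blast
qed

lemma continuous_map_profile_restrict:
  assumes "J \<subseteq> I"
  shows "continuous_map (profile_topology I E N C) (profile_topology J E N C) (\<lambda>x. restrict x J)"
  unfolding profile_topology_def continuous_map_componentwise
  using assms by (auto intro!: continuous_map_product_projection)

lemma continuous_map_profile_update:
  assumes "i \<in> {1..p}"
  shows "continuous_map
    (prod_topology (profile_topology (opponents p i) E N C) (strategy_topology (E i) (N i) (C i)))
    (profile_topology {1..p} E N C) (\<lambda>(y, z). y(i := z))"
proof -
  let ?T = "\<lambda>j. strategy_topology (E j) (N j) (C j)"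
  let ?X = "prod_topology (product_topology ?T (opponents p i)) (?T i)"
  have "continuous_map ?X (?T j) (\<lambda>w. ((fst w)(i := snd w)) j)" if "j \<in> {1..p}" for j
  proof (cases "j = i")
    case True
    then show ?thesis by (simp add: continuous_map_snd)
  next
    case False
    with that have "j \<in> opponents p i"
      by (simp add: opponents_def)
    then have "continuous_map ?X (?T j) ((\<lambda>y. y j) \<circ> fst)"
      by (rule continuous_map_compose[OF continuous_map_fst continuous_map_product_projection])
    with False show ?thesis by (simp add: comp_def)
  qed
  moreover have "(\<lambda>w. (fst w)(i := snd w)) ` topspace ?X \<subseteq> extensional {1..p}"
    using assms by (auto simp: opponents_def extensional_def PiE_def)
  ultimately show ?thesis
    unfolding profile_topology_def continuous_map_componentwise case_prod_beta by blast
qed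

lemma restrict_update_opponents:
  assumes "y \<in> profiles (opponents p i) C"
  shows "restrict (y(i := z)) (opponents p i) = y"
  using assms by (auto simp: profiles_def opponents_def PiE_iff extensional_def)

lemma restrict_profile:
  assumes "x \<in> profiles {1..p} C"
  shows "restrict x (opponents p i) \<in> profiles (opponents p i) C"
  using assms by (auto simp: profiles_def opponents_def PiE_iff)

lemma update_restrict_profile:
  assumes "x \<in> profiles {1..p} C" "i \<in> {1..p}"
  shows "(restrict x (opponents p i))(i := x i) = x"
  using assms by (auto simp: profiles_def opponents_def PiE_iff extensional_def)


section \<open>From Nash equilibria to generalized Nash equilibria\<close>

text \<open>
  The consequences of the hypotheses of assertion (B) that the argument uses. The normed spaces and
  the strategy sets of all players are needed for the topology of profiles; payoffs and constraints
  enter only through the one-player problem with the opponents' profiles as parameters.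
\<close>

locale generalized_nash_game =
  fixes p :: nat and E :: "nat \<Rightarrow> 'a::real_vector set" and N :: "nat \<Rightarrow> 'a \<Rightarrow> real"
    and C :: "nat \<Rightarrow> 'a set" and \<theta> :: "nat \<Rightarrow> (nat \<Rightarrow> 'a) \<Rightarrow> real"
    and K :: "nat \<Rightarrow> (nat \<Rightarrow> 'a) \<Rightarrow> 'a set"
  assumes strategies_normed: "i \<in> {1..p} \<Longrightarrow> normed_space_on (E i) (N i)"
    and strategies_subset: "i \<in> {1..p} \<Longrightarrow> C i \<subseteq> E i"
    and strategies_compact: "i \<in> {1..p} \<Longrightarrow> compactin (norm_topology (E i) (N i)) (C i)"
    and player: "i \<in> {1..p} \<Longrightarrow> constrained_maximization (E i) (N i) (C i)
      (profile_topology (opponents p i) E N C) (\<lambda>y z. \<theta> i (y(i := z))) (K i)"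
begin

abbreviation replies :: "nat \<Rightarrow> real \<Rightarrow> (nat \<Rightarrow> 'a) \<Rightarrow> 'a set" where
  "replies i \<equiv> approx_replies (N i) (C i) (\<lambda>y z. \<theta> i (y(i := z))) (K i)"

definition approx_equilibrium :: "real \<Rightarrow> (nat \<Rightarrow> 'a) \<Rightarrow> bool" where
  "approx_equilibrium e x \<longleftrightarrow> x \<in> profiles {1..p} C \<and>
    (\<forall>i \<in> {1..p}. x i \<in> replies i e (restrict x (opponents p i)))"

lemma approx_equilibrium_mono:
  assumes "e \<le> e'" "approx_equilibrium e x"
  shows "approx_equilibrium e' x"
proof -
  have "x i \<in> replies i e' (restrict x (opponents p i))" if "i \<in> {1..p}" for i
    using assms(2) that unfolding approx_equilibrium_def
    by (intro subsetD[OF approx_replies_mono[OF assms(1)]]) blast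
  then show ?thesis
    using assms(2) unfolding approx_equilibrium_def by blast
qed

lemma topspace_profiles:
  "I \<subseteq> {1..p} \<Longrightarrow> topspace (profile_topology I E N C) = profiles I C"
  by (intro topspace_profile_topology strategies_normed strategies_subset) blast+

lemma opponents_subset: "opponents p i \<subseteq> {1..p}"
  by (auto simp: opponents_def)

text \<open>
  One payoff function of the game to which assertion (A) is applied. The weighted mean \<open>w\<close> of the
  replies \<open>z k\<close> is an approximate reply by convexity. It gives player \<open>i\<close> the payoff \<open>0\<close>, whereas
  every other strategy gives a negative one; so a strategy that is optimal for this payoff equals \<open>w\<close>.
\<close>

lemma auxiliary_payoff:
  assumes i: "i \<in> {1..p}" and e: "e > 0"
  obtains f where "continuous_map (profile_topology {1..p} E N C) euclideanreal f"
    "quasi_concave_in p C i f"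
    "\<And>x. x \<in> profiles {1..p} C \<Longrightarrow>
      (\<And>z. z \<in> C i \<Longrightarrow> f ((restrict x (opponents p i))(i := z)) \<le> f x) \<Longrightarrow>
      x i \<in> replies i e (restrict x (opponents p i))"
proof -
  let ?J = "opponents p i"
  let ?X = "profile_topology ?J E N C"
  interpret constrained_maximization "E i" "N i" "C i" ?X "\<lambda>y z. \<theta> i (y(i := z))" "K i"
    by (rule player[OF i])
  have topX: "topspace ?X = profiles ?J C"
    by (rule topspace_profiles[OF opponents_subset])
  have J: "j \<in> {1..p}" if "j \<in> ?J" for j
    using that opponents_subset by blast
  have "compact_space ?X" "completely_regular_space ?X"
    using J strategies_compact strategies_normed
    by (auto intro!: compact_space_profile_topology completely_regular_space_profile_topology
        simp del: atLeastAtMost_iff)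
  then obtain F :: "(nat \<Rightarrow> 'a) set" and z g where F: "finite F"
    and zg: "\<forall>k\<in>F. z k \<in> C i \<and> continuous_map ?X euclideanreal (g k) \<and>
      (\<forall>y\<in>topspace ?X. 0 \<le> g k y \<and> (0 < g k y \<longrightarrow> z k \<in> replies i e y))"
    and g_sum: "\<forall>y\<in>topspace ?X. 0 < (\<Sum>k\<in>F. g k y)"
    using e by (rule approx_replies_weights)
  have zC: "z k \<in> C i" and g_cont: "continuous_map ?X euclideanreal (g k)" if "k \<in> F" for k
    using zg that by blast+
  have g_nonneg: "0 \<le> g k y" and g_pos: "0 < g k y \<Longrightarrow> z k \<in> replies i e y"
    if "k \<in> F" "y \<in> topspace ?X" for k y
    using zg that by blast+
  have zE: "z k \<in> E i" if "k \<in> F" for k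
    using zC[OF that] strategies_subset[OF i] by blast
  define f where "f x = - N i (\<Sum>k\<in>F. g k (restrict x ?J) *\<^sub>R (x i - z k))" for x
  show thesis
  proof (rule that[of f])
    show "continuous_map (profile_topology {1..p} E N C) euclideanreal f"
      unfolding f_def
    proof (intro continuous_map_minus continuous_map_norm_weighted_sum F zE)
      fix k
      assume "k \<in> F"
      from continuous_map_compose[OF continuous_map_profile_restrict[OF opponents_subset] g_cont[OF this]]
      show "continuous_map (profile_topology {1..p} E N C) euclideanreal (\<lambda>x. g k (restrict x ?J))"
        by (simp add: comp_def)
    next
      have "continuous_map (profile_topology {1..p} E N C) (strategy_topology (E i) (N i) (C i))
          (\<lambda>x. x i)"
        unfolding profile_topology_def using i by (rule continuous_map_product_projection)
      then show "continuous_map (profile_topology {1..p} E N C) (norm_topology (E i) (N i))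
          (\<lambda>x. x i)"
        unfolding strategy_topology_def by (simp add: continuous_map_in_subtopology)
    qed
    show "quasi_concave_in p C i f"
      unfolding quasi_concave_in_def
    proof (intro ballI allI)
      fix y :: "nat \<Rightarrow> 'a" and r :: real
      assume y: "y \<in> profiles ?J C"
      have "{w \<in> C i. f (y(i := w)) \<ge> r} = {w \<in> C i. N i (\<Sum>k\<in>F. g k y *\<^sub>R (w - z k)) \<le> - r}"
        unfolding f_def restrict_update_opponents[OF y] by auto
      then show "convex {w \<in> C i. f (y(i := w)) \<ge> r}"
        using convex_norm_weighted_sum[OF convex_C strategies_subset[OF i] zE] by simp
    qed
    fix x
    assume x: "x \<in> profiles {1..p} C"
      and opt: "\<And>w. w \<in> C i \<Longrightarrow> f ((restrict x ?J)(i := w)) \<le> f x"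
    let ?y = "restrict x ?J"
    let ?s = "\<Sum>k\<in>F. g k ?y"
    have y: "?y \<in> profiles ?J C"
      using x by (rule restrict_profile)
    then have yX: "?y \<in> topspace ?X"
      using topX by simp
    have s: "?s > 0"
      using g_sum yX by blast
    define w where "w = (\<Sum>k\<in>F. (g k ?y / ?s) *\<^sub>R z k)"
    \<comment> \<open>Only the \<open>z k\<close> with positive weight are known to be approximate replies to \<open>?y\<close>.\<close>
    let ?G = "{k \<in> F. 0 < g k ?y}"
    have zero: "g k ?y = 0" if "k \<in> F - ?G" for k
      using that g_nonneg[OF _ yX, of k] by auto
    have w_G: "w = (\<Sum>k\<in>?G. (g k ?y / ?s) *\<^sub>R z k)"
      unfolding w_def using F zero by (intro sum.mono_neutral_right) auto
    have s_G: "(\<Sum>k\<in>?G. g k ?y / ?s) = 1"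
    proof -
      have "(\<Sum>k\<in>?G. g k ?y) = ?s"
        using F zero by (intro sum.mono_neutral_left) auto
      then show ?thesis
        using s by (simp flip: sum_divide_distrib)
    qed
    have wP: "w \<in> replies i e ?y"
      unfolding w_G using F s s_G g_pos[OF _ yX]
      by (intro convex_sum convex_approx_replies[OF yX]) auto
    then have wC: "w \<in> C i"
      by (simp add: approx_replies_def)
    \<comment> \<open>The payoff of \<open>v\<close> is a positive multiple of minus its distance to \<open>w\<close>.\<close>
    have sum_eq: "(\<Sum>k\<in>F. g k ?y *\<^sub>R (v - z k)) = ?s *\<^sub>R (v - w)" for v
    proof -
      have "?s *\<^sub>R w = (\<Sum>k\<in>F. g k ?y *\<^sub>R z k)"
        unfolding w_def scaleR_sum_right using s by (intro sum.cong) auto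
      then show ?thesis
        by (simp add: scaleR_diff_right sum_subtractf scaleR_sum_left)
    qed
    have "f (?y(i := w)) = - N i (?s *\<^sub>R (w - w))"
      unfolding f_def restrict_update_opponents[OF y] by (simp add: sum_eq)
    also have "\<dots> = 0"
      using norm_eq_0_iff[of 0] subspace by (simp add: subspace_0)
    finally have "N i (?s *\<^sub>R (x i - w)) \<le> 0"
      using opt[OF wC] unfolding f_def sum_eq by linarith
    moreover have xw: "x i - w \<in> E i"
      using x wC i strategies_subset[OF i] subspace by (auto simp: profiles_def intro!: subspace_diff)
    ultimately have "N i (x i - w) \<le> 0"
      using s by (simp add: norm_scale mult_le_0_iff)
    then have "x i = w"
      using norm_nonneg[OF xw] norm_eq_0_iff[OF xw] by simp
    with wP show "x i \<in> replies i e ?y" by simp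
  qed
qed

lemma not_equilibrium_near:
  assumes x: "x \<in> profiles {1..p} C" and no: "\<not> generalized_nash_equilibrium p C \<theta> K x"
  obtains U e where "openin (profile_topology {1..p} E N C) U" "x \<in> U" "e > 0"
    "\<And>x'. x' \<in> U \<Longrightarrow> \<not> approx_equilibrium e x'"
proof -
  let ?T = "profile_topology {1..p} E N C"
  obtain i where i: "i \<in> {1..p}" and bad: "\<not> (x i \<in> K i (restrict x (opponents p i)) \<and>
      (\<forall>z \<in> K i (restrict x (opponents p i)). \<theta> i ((restrict x (opponents p i))(i := z)) \<le> \<theta> i x))"
    using x no unfolding generalized_nash_equilibrium_def by blast
  let ?J = "opponents p i"
  let ?X = "profile_topology ?J E N C"
  let ?Y = "strategy_topology (E i) (N i) (C i)"
  interpret constrained_maximization "E i" "N i" "C i" ?X "\<lambda>y z. \<theta> i (y(i := z))" "K i"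
    by (rule player[OF i])
  have y: "restrict x ?J \<in> topspace ?X"
    using topspace_profiles[OF opponents_subset] restrict_profile[OF x] by blast
  have xi: "x i \<in> C i"
    using x i by (auto simp: profiles_def)
  have "\<not> (x i \<in> K i (restrict x ?J) \<and> (\<forall>z \<in> K i (restrict x ?J).
      \<theta> i ((restrict x ?J)(i := z)) \<le> \<theta> i ((restrict x ?J)(i := x i))))"
    unfolding update_restrict_profile[OF x i] by (rule bad)
  then obtain W e where W: "openin (prod_topology ?X ?Y) W" "(restrict x ?J, x i) \<in> W"
    and e: "e > 0" and far: "\<And>y' x'. (y', x') \<in> W \<Longrightarrow> x' \<notin> replies i e y'"
    using not_approx_reply_near[OF y xi] by blast
  have "continuous_map ?T (prod_topology ?X ?Y) (\<lambda>x. (restrict x ?J, x i))"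
    using i by (intro continuous_map_pairedI continuous_map_profile_restrict opponents_subset)
      (auto simp: profile_topology_def intro: continuous_map_product_projection)
  then have "openin ?T {x' \<in> topspace ?T. (restrict x' ?J, x' i) \<in> W}"
    using W(1) by (rule openin_continuous_map_preimage)
  moreover have "\<not> approx_equilibrium e x'" if "(restrict x' ?J, x' i) \<in> W" for x'
    using far[OF that] i unfolding approx_equilibrium_def by blast
  moreover have "x \<in> topspace ?T"
    using x topspace_profiles by blast
  ultimately show thesis
    using W(2) e by (intro that[of "{x' \<in> topspace ?T. (restrict x' ?J, x' i) \<in> W}" e]) auto
qed

lemma equilibrium_if_approx_equilibria:
  assumes approx: "\<And>e. e > 0 \<Longrightarrow> \<exists>x. approx_equilibrium e x"
  shows "\<exists>x. generalized_nash_equilibrium p C \<theta> K x"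
proof (rule ccontr)
  assume no: "\<nexists>x. generalized_nash_equilibrium p C \<theta> K x"
  let ?T = "profile_topology {1..p} E N C"
  have top: "topspace ?T = profiles {1..p} C"
    by (rule topspace_profiles) simp
  have "\<exists>U e. openin ?T U \<and> x \<in> U \<and> e > 0 \<and> (\<forall>x' \<in> U. \<not> approx_equilibrium e x')"
    if "x \<in> topspace ?T" for x
    using not_equilibrium_near[of x] no that top by metis
  then obtain U e where U: "\<And>x. x \<in> topspace ?T \<Longrightarrow> openin ?T (U x)"
    "\<And>x. x \<in> topspace ?T \<Longrightarrow> x \<in> U x" "\<And>x. x \<in> topspace ?T \<Longrightarrow> (e x :: real) > 0"
    "\<And>x x'. x \<in> topspace ?T \<Longrightarrow> x' \<in> U x \<Longrightarrow> \<not> approx_equilibrium (e x) x'"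
    by metis
  have "compact_space ?T"
    using strategies_compact by (rule compact_space_profile_topology)
  then obtain F where F: "finite F" "F \<subseteq> topspace ?T" "topspace ?T \<subseteq> \<Union> (U ` F)"
    using U(1,2) by (rule compact_space_neighbourhood_cover)
  \<comment> \<open>The \<open>1\<close> makes the minimum meaningful even if \<open>F\<close> is empty.\<close>
  define d where "d = Min (insert 1 (e ` F))"
  have "d > 0"
    unfolding d_def using F(1,2) U(3) by auto
  then obtain x where x: "approx_equilibrium d x"
    using approx by blast
  then have "x \<in> topspace ?T"
    unfolding approx_equilibrium_def top by blast
  then obtain a where a: "a \<in> F" "x \<in> U a"
    using F(3) by blast
  have "d \<le> e a"
    unfolding d_def using F(1) a(1) by simp
  then have "approx_equilibrium (e a) x"
    using x by (rule approx_equilibrium_mono)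
  moreover have "a \<in> topspace ?T"
    using a(1) F(2) by blast
  ultimately show False
    using U(4)[OF _ a(2)] by simp
qed

end

theorem theorem5p6:
  assumes A:
    "\<forall>(p :: nat) (E :: nat \<Rightarrow> 'a::real_vector set) (N :: nat \<Rightarrow> 'a \<Rightarrow> real)
       (C :: nat \<Rightarrow> 'a set) (\<theta> :: nat \<Rightarrow> (nat \<Rightarrow> 'a) \<Rightarrow> real).
       (\<forall>i \<in> {1..p}.
          banach_space_on (E i) (N i) \<and>
          C i \<subseteq> E i \<and>
          compactin (norm_topology (E i) (N i)) (C i) \<and> convex (C i) \<and> C i \<noteq> {} \<and>
          continuous_map (profile_topology {1..p} E N C) euclideanreal (\<theta> i) \<and>
          quasi_concave_in p C i (\<theta> i))
       \<longrightarrow> (\<exists>x. nash_equilibrium p C \<theta> x)"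
  shows
    "\<forall>(p :: nat) (E :: nat \<Rightarrow> 'a set) (N :: nat \<Rightarrow> 'a \<Rightarrow> real)
       (C :: nat \<Rightarrow> 'a set) (\<theta> :: nat \<Rightarrow> (nat \<Rightarrow> 'a) \<Rightarrow> real)
       (K :: nat \<Rightarrow> (nat \<Rightarrow> 'a) \<Rightarrow> 'a set).
       (\<forall>i \<in> {1..p}.
          banach_space_on (E i) (N i) \<and>
          C i \<subseteq> E i \<and>
          compactin (norm_topology (E i) (N i)) (C i) \<and> convex (C i) \<and> C i \<noteq> {} \<and>
          continuous_map (profile_topology {1..p} E N C) euclideanreal (\<theta> i) \<and>
          quasi_concave_in p C i (\<theta> i) \<and>
          (\<forall>y \<in> profiles (opponents p i) C. K i y \<subseteq> C i) \<and>
          lower_hemicontinuous (profile_topology (opponents p i) E N C)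
            (strategy_topology (E i) (N i) (C i)) (K i) \<and>
          upper_hemicontinuous (profile_topology (opponents p i) E N C)
            (strategy_topology (E i) (N i) (C i)) (K i) \<and>
          (\<forall>y \<in> profiles (opponents p i) C.
             convex (K i y) \<and> closedin (strategy_topology (E i) (N i) (C i)) (K i y) \<and>
             K i y \<noteq> {}))
       \<longrightarrow> (\<exists>x. generalized_nash_equilibrium p C \<theta> K x)"
proof (intro allI impI)
  fix p :: nat and E :: "nat \<Rightarrow> 'a set" and N :: "nat \<Rightarrow> 'a \<Rightarrow> real"
    and C :: "nat \<Rightarrow> 'a set" and \<theta> :: "nat \<Rightarrow> (nat \<Rightarrow> 'a) \<Rightarrow> real"
    and K :: "nat \<Rightarrow> (nat \<Rightarrow> 'a) \<Rightarrow> 'a set"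
  assume game: "\<forall>i \<in> {1..p}.
          banach_space_on (E i) (N i) \<and>
          C i \<subseteq> E i \<and>
          compactin (norm_topology (E i) (N i)) (C i) \<and> convex (C i) \<and> C i \<noteq> {} \<and>
          continuous_map (profile_topology {1..p} E N C) euclideanreal (\<theta> i) \<and>
          quasi_concave_in p C i (\<theta> i) \<and>
          (\<forall>y \<in> profiles (opponents p i) C. K i y \<subseteq> C i) \<and>
          lower_hemicontinuous (profile_topology (opponents p i) E N C)
            (strategy_topology (E i) (N i) (C i)) (K i) \<and>
          upper_hemicontinuous (profile_topology (opponents p i) E N C)
            (strategy_topology (E i) (N i) (C i)) (K i) \<and>
          (\<forall>y \<in> profiles (opponents p i) C.
             convex (K i y) \<and> closedin (strategy_topology (E i) (N i) (C i)) (K i y) \<and>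
             K i y \<noteq> {})"
  have normed: "normed_space_on (E i) (N i)" if "i \<in> {1..p}" for i
    using game that banach_space_on.axioms(1) by blast
  have top: "topspace (profile_topology (opponents p i) E N C) = profiles (opponents p i) C" for i
    using game normed by (intro topspace_profile_topology) (auto simp: opponents_def)
  interpret generalized_nash_game p E N C \<theta> K
  proof (rule generalized_nash_game.intro)
    fix i
    assume i: "i \<in> {1..p}"
    show "normed_space_on (E i) (N i)"
      by (rule normed[OF i])
    show "C i \<subseteq> E i" "compactin (norm_topology (E i) (N i)) (C i)"
      using game i by blast+
    have "continuous_map (profile_topology {1..p} E N C) euclideanreal (\<theta> i)"
      using game i by blast
    from continuous_map_compose[OF continuous_map_profile_update[OF i] this]
    have "continuous_map
        (prod_topology (profile_topology (opponents p i) E N C) (strategy_topology (E i) (N i) (C i)))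
        euclideanreal (\<lambda>(y, z). \<theta> i (y(i := z)))"
      by (simp add: comp_def case_prod_unfold)
    then show "constrained_maximization (E i) (N i) (C i)
        (profile_topology (opponents p i) E N C) (\<lambda>y z. \<theta> i (y(i := z))) (K i)"
      using game i normed[OF i] top[of i] unfolding quasi_concave_in_def
      by (intro constrained_maximization.intro constrained_maximization_axioms.intro) auto
  qed
  show "\<exists>x. generalized_nash_equilibrium p C \<theta> K x"
  proof (rule equilibrium_if_approx_equilibria)
    fix e :: real
    assume "e > 0"
    then have "\<forall>i \<in> {1..p}. \<exists>f. continuous_map (profile_topology {1..p} E N C) euclideanreal f \<and>
        quasi_concave_in p C i f \<and>
        (\<forall>x \<in> profiles {1..p} C.
          (\<forall>z \<in> C i. f ((restrict x (opponents p i))(i := z)) \<le> f x) \<longrightarrow>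
          x i \<in> replies i e (restrict x (opponents p i)))"
      using auxiliary_payoff by metis
    then obtain f where f: "\<And>i. i \<in> {1..p} \<Longrightarrow>
        continuous_map (profile_topology {1..p} E N C) euclideanreal (f i) \<and>
        quasi_concave_in p C i (f i) \<and>
        (\<forall>x \<in> profiles {1..p} C.
          (\<forall>z \<in> C i. f i ((restrict x (opponents p i))(i := z)) \<le> f i x) \<longrightarrow>
          x i \<in> replies i e (restrict x (opponents p i)))"
      by metis
    have "\<exists>x. nash_equilibrium p C f x"
      by (rule A[rule_format, of p E N C f]) (use game f in blast)
    then obtain x where "nash_equilibrium p C f x" ..
    then have "approx_equilibrium e x"
      using f unfolding nash_equilibrium_def approx_equilibrium_def by blast
    then show "\<exists>x. approx_equilibrium e x" by blast
  qed
qed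

end
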